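(* Let $(\mathcal{A},\cdot)$ be a super commutative associative algebra over $\mathbb{C}$, let $W(\mathcal{A})=W(\mathcal{A})_0+W(\mathcal{A})_1$ be the Lie superalgebra of its derivations ($W(\mathcal{A})_0$ the even derivations, $W(\mathcal{A})_1$ the odd derivations), and let $\mathcal{N}=W(\mathcal{A})\oplus\mathcal{A}$ with grading $\mathcal{N}_i=W(\mathcal{A})_i+\mathcal{A}_i$. Define operations on $\mathcal{N}$ by $$[d_1+\xi_1,d_2+\xi_2]=[d_1,d_2]+d_1(\xi_2)-(-1)^{ij}d_2(\xi_1),$$ $$(d_1+\xi_1)\circ(d_2+\xi_2)=(-1)^{ij}\xi_2d_1+\xi_1\xi_2$$ for $d_1+\xi_1\in\mathcal{N}_i$ and $d_2+\xi_2\in\mathcal{N}_j$. Then $(\mathcal{N},[\cdot,\cdot],\circ)$ is a super Gel'fand-Dorfman bialgebra.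
   Context: All vector spaces are over $\mathbb{C}$. A super commutative associative algebra is a $\mathbb{Z}_2$-graded associative algebra $\mathcal{A}=\mathcal{A}_0\oplus\mathcal{A}_1$ with $uv=(-1)^{ij}vu$ for $u\in\mathcal{A}_i,v\in\mathcal{A}_j$. A linear map $d:\mathcal{A}\to\mathcal{A}$ is a derivation of parity $i\in\mathbb{Z}_2$ (even if $i=0$, odd if $i=1$) if $d(\mathcal{A}_j)\subset\mathcal{A}_{i+j}$ and $d(uv)=d(u)v+(-1)^{ij}u\,d(v)$ for $j\in\mathbb{Z}_2$, $u\in\mathcal{A}_j$, $v\in\mathcal{A}$. The bracket on $W(\mathcal{A})$ is $[d_1,d_2](v)=d_1(d_2(v))-(-1)^{ij}d_2(d_1(v))$ for $d_1\in W(\mathcal{A})_i$, $d_2\in W(\mathcal{A})_j$, $v\in\mathcal{A}$. $W(\mathcal{A})$ is a left $\mathcal{A}$-module via $(ad)(v)=a\,d(v)$ for $a,v\in\mathcal{A}$, $d\in W(\mathcal{A})$. All operations below are bilinear and $\mathbb{Z}_2$-graded. A Lie superalgebra $L=L_0\oplus L_1$ satisfies $[u,v]=-(-1)^{ij}[v,u]$ and $[w,[v,u]]=[[w,v],u]-(-1)^{ij}[[w,u],v]$ for $u\in L_i,v\in L_j,w\in L$. A Novikov superalgebra $(\mathcal{B},\circ)$ satisfies $(u\circ v)\circ w=(-1)^{jl}(u\circ w)\circ v$ and $(u,v,w)=(-1)^{ij}(v,u,w)$ for $u\in\mathcal{B}_i,v\in\mathcal{B}_j,w\in\mathcal{B}_l$,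 where $(u,v,w)=(u\circ v)\circ w-u\circ(v\circ w)$. A super Gel'fand-Dorfman bialgebra $(\mathcal{B},[\cdot,\cdot],\circ)$ is a $\mathbb{Z}_2$-graded space such that $(\mathcal{B},[\cdot,\cdot])$ is a Lie superalgebra, $(\mathcal{B},\circ)$ is a Novikov superalgebra and $$[w\circ u,v]-(-1)^{ij}[w\circ v,u]+[w,u]\circ v-(-1)^{ij}[w,v]\circ u-w\circ[u,v]=0$$ for $u\in\mathcal{B}_i$, $v\in\mathcal{B}_j$, $w\in\mathcal{B}$. *)

theory Defs
  imports
    Complex_Main
    "HOL-Library.Z2"
    "HOL-Library.Function_Algebras"
    "HOL-Library.Product_Plus"
begin

section \<open>Superalgebras\<close>

text \<open>
  The group of parities is the type \<^typ>\<open>bit\<close>, so \<^term>\<open>psign (i * j)\<close> is the usual sign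
  \<open>(-1)\<^sup>i\<^sup>j\<close>.
\<close>

definition psign :: "bit \<Rightarrow> complex"
  where "psign k = (if k = 0 then 1 else -1)"

text \<open>
  A graded space is a set \<open>V\<close> inside an ambient complex vector space which is the internal direct
  sum of two subspaces \<open>G 0\<close> and \<open>G 1\<close>. The scalar multiplication is an explicit parameter.
\<close>

locale super_space = vector_space scale
  for scale :: "complex \<Rightarrow> 'v::ab_group_add \<Rightarrow> 'v" +
  fixes V :: "'v set" and G :: "bit \<Rightarrow> 'v set"
  assumes subspace_component: "subspace (G i)"
    and components_disjoint: "G 0 \<inter> G 1 = {0}"
    and carrier_eq: "V = {x + y | x y. x \<in> G 0 \<and> y \<in> G 1}"

locale super_algebra = super_space scale V G
  for scale :: "complex \<Rightarrow> 'v::ab_group_add \<Rightarrow> 'v" and V :: "'v set" and G :: "bit \<Rightarrow> 'v set" +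
  fixes m :: "'v \<Rightarrow> 'v \<Rightarrow> 'v"
  assumes closed: "\<lbrakk>x \<in> V; y \<in> V\<rbrakk> \<Longrightarrow> m x y \<in> V"
    and graded: "\<lbrakk>x \<in> G i; y \<in> G j\<rbrakk> \<Longrightarrow> m x y \<in> G (i + j)"
    and add_left: "\<lbrakk>x \<in> V; y \<in> V; z \<in> V\<rbrakk> \<Longrightarrow> m (x + y) z = m x z + m y z"
    and add_right: "\<lbrakk>x \<in> V; y \<in> V; z \<in> V\<rbrakk> \<Longrightarrow> m x (y + z) = m x y + m x z"
    and scale_left: "\<lbrakk>x \<in> V; y \<in> V\<rbrakk> \<Longrightarrow> m (scale c x) y = scale c (m x y)"
    and scale_right: "\<lbrakk>x \<in> V; y \<in> V\<rbrakk> \<Longrightarrow> m x (scale c y) = scale c (m x y)"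

text \<open>
  For the commutative algebra the carrier is the whole type; associativity comes from the class
  \<^class>\<open>ring\<close>, and no unit is assumed.
\<close>

locale super_comm_algebra = super_algebra scale UNIV A "(*)"
  for scale :: "complex \<Rightarrow> 'a::ring \<Rightarrow> 'a" and A :: "bit \<Rightarrow> 'a set" +
  assumes supercommute: "\<lbrakk>u \<in> A i; v \<in> A j\<rbrakk> \<Longrightarrow> u * v = scale (psign (i * j)) (v * u)"

locale lie_superalgebra = super_algebra scale V G br
  for scale :: "complex \<Rightarrow> 'v::ab_group_add \<Rightarrow> 'v" and V :: "'v set" and G :: "bit \<Rightarrow> 'v set"
    and br :: "'v \<Rightarrow> 'v \<Rightarrow> 'v" +
  assumes super_skew: "\<lbrakk>u \<in> G i; v \<in> G j\<rbrakk> \<Longrightarrow> br u v = - scale (psign (i * j)) (br v u)"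
    and super_jacobi: "\<lbrakk>u \<in> G i; v \<in> G j; w \<in> V\<rbrakk> \<Longrightarrow>
      br w (br v u) = br (br w v) u - scale (psign (i * j)) (br (br w u) v)"

locale novikov_superalgebra = super_algebra scale V G circ
  for scale :: "complex \<Rightarrow> 'v::ab_group_add \<Rightarrow> 'v" and V :: "'v set" and G :: "bit \<Rightarrow> 'v set"
    and circ :: "'v \<Rightarrow> 'v \<Rightarrow> 'v" +
  assumes right_supercommute: "\<lbrakk>u \<in> G i; v \<in> G j; w \<in> G l\<rbrakk> \<Longrightarrow>
      circ (circ u v) w = scale (psign (j * l)) (circ (circ u w) v)"
    and left_supersymmetric: "\<lbrakk>u \<in> G i; v \<in> G j; w \<in> G l\<rbrakk> \<Longrightarrow>
      circ (circ u v) w - circ u (circ v w) =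
      scale (psign (i * j)) (circ (circ v u) w - circ v (circ u w))"

locale super_gelfand_dorfman =
  lie_superalgebra scale V G br + novikov_superalgebra scale V G circ
  for scale :: "complex \<Rightarrow> 'v::ab_group_add \<Rightarrow> 'v" and V :: "'v set" and G :: "bit \<Rightarrow> 'v set"
    and br circ :: "'v \<Rightarrow> 'v \<Rightarrow> 'v" +
  assumes compatible: "\<lbrakk>u \<in> G i; v \<in> G j; w \<in> V\<rbrakk> \<Longrightarrow>
      br (circ w u) v - scale (psign (i * j)) (br (circ w v) u) + circ (br w u) v
      - scale (psign (i * j)) (circ (br w v) u) - circ w (br u v) = 0"


section \<open>Operations given on homogeneous elements\<close>

text \<open>
  \<open>component G i x\<close> is the part of \<open>x\<close> of parity \<open>i\<close>, and if every \<open>f i j\<close> is bilinear on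
  \<open>G i \<times> G j\<close>, then \<open>bilinear_ext G f\<close> is the bilinear operation agreeing with all of them.
\<close>

definition component :: "(bit \<Rightarrow> 'v::ab_group_add set) \<Rightarrow> bit \<Rightarrow> 'v \<Rightarrow> 'v"
  where "component G i x = (THE y. y \<in> G i \<and> x - y \<in> G (i + 1))"

definition bilinear_ext ::
  "(bit \<Rightarrow> 'v::ab_group_add set) \<Rightarrow> (bit \<Rightarrow> bit \<Rightarrow> 'v \<Rightarrow> 'v \<Rightarrow> 'v) \<Rightarrow> 'v \<Rightarrow> 'v \<Rightarrow> 'v"
  where "bilinear_ext G f x y = (\<Sum>i\<in>UNIV. \<Sum>j\<in>UNIV. f i j (component G i x) (component G j y))"


section \<open>Derivations\<close>

definition der :: "(complex \<Rightarrow> 'a::ring \<Rightarrow> 'a) \<Rightarrow> (bit \<Rightarrow> 'a set) \<Rightarrow> bit \<Rightarrow> ('a \<Rightarrow> 'a) set"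
  where "der scale A i = {d. Vector_Spaces.linear scale scale d \<and>
    (\<forall>j. d ` A j \<subseteq> A (i + j)) \<and>
    (\<forall>j. \<forall>u\<in>A j. \<forall>v. d (u * v) = d u * v + scale (psign (i * j)) (u * d v))}"

definition W_carrier :: "(complex \<Rightarrow> 'a::ring \<Rightarrow> 'a) \<Rightarrow> (bit \<Rightarrow> 'a set) \<Rightarrow> ('a \<Rightarrow> 'a) set"
  where "W_carrier scale A = {d + d' | d d'. d \<in> der scale A 0 \<and> d' \<in> der scale A 1}"

definition W_bracket ::
  "(complex \<Rightarrow> 'a::ring \<Rightarrow> 'a) \<Rightarrow> (bit \<Rightarrow> 'a set) \<Rightarrow> ('a \<Rightarrow> 'a) \<Rightarrow> ('a \<Rightarrow> 'a) \<Rightarrow> 'a \<Rightarrow> 'a"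
  where "W_bracket scale A = bilinear_ext (der scale A)
    (\<lambda>i j d\<^sub>1 d\<^sub>2 v. d\<^sub>1 (d\<^sub>2 v) - scale (psign (i * j)) (d\<^sub>2 (d\<^sub>1 v)))"

definition act :: "'a::ring \<Rightarrow> ('a \<Rightarrow> 'a) \<Rightarrow> 'a \<Rightarrow> 'a"
  where "act a d v = a * d v"


section \<open>The space of derivations and functions\<close>

definition N_scale :: "(complex \<Rightarrow> 'a::ring \<Rightarrow> 'a) \<Rightarrow> complex \<Rightarrow> ('a \<Rightarrow> 'a) \<times> 'a \<Rightarrow> ('a \<Rightarrow> 'a) \<times> 'a"
  where "N_scale scale c = (\<lambda>(d, \<xi>). (\<lambda>v. scale c (d v), scale c \<xi>))"

definition N_carrier :: "(complex \<Rightarrow> 'a::ring \<Rightarrow> 'a) \<Rightarrow> (bit \<Rightarrow> 'a set) \<Rightarrow> (('a \<Rightarrow> 'a) \<times> 'a) set"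
  where "N_carrier scale A = W_carrier scale A \<times> UNIV"

definition N_grading ::
  "(complex \<Rightarrow> 'a::ring \<Rightarrow> 'a) \<Rightarrow> (bit \<Rightarrow> 'a set) \<Rightarrow> bit \<Rightarrow> (('a \<Rightarrow> 'a) \<times> 'a) set"
  where "N_grading scale A i = der scale A i \<times> A i"

definition N_bracket ::
  "(complex \<Rightarrow> 'a::ring \<Rightarrow> 'a) \<Rightarrow> (bit \<Rightarrow> 'a set) \<Rightarrow>
    ('a \<Rightarrow> 'a) \<times> 'a \<Rightarrow> ('a \<Rightarrow> 'a) \<times> 'a \<Rightarrow> ('a \<Rightarrow> 'a) \<times> 'a"
  where "N_bracket scale A = bilinear_ext (N_grading scale A)
    (\<lambda>i j (d\<^sub>1, \<xi>\<^sub>1) (d\<^sub>2, \<xi>\<^sub>2).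
      (W_bracket scale A d\<^sub>1 d\<^sub>2, d\<^sub>1 \<xi>\<^sub>2 - scale (psign (i * j)) (d\<^sub>2 \<xi>\<^sub>1)))"

definition N_circ ::
  "(complex \<Rightarrow> 'a::ring \<Rightarrow> 'a) \<Rightarrow> (bit \<Rightarrow> 'a set) \<Rightarrow>
    ('a \<Rightarrow> 'a) \<times> 'a \<Rightarrow> ('a \<Rightarrow> 'a) \<times> 'a \<Rightarrow> ('a \<Rightarrow> 'a) \<times> 'a"
  where "N_circ scale A = bilinear_ext (N_grading scale A)
    (\<lambda>i j (d\<^sub>1, \<xi>\<^sub>1) (d\<^sub>2, \<xi>\<^sub>2). (\<lambda>v. scale (psign (i * j)) (act \<xi>\<^sub>2 d\<^sub>1 v), \<xi>\<^sub>1 * \<xi>\<^sub>2))"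


section \<open>The operations on homogeneous elements\<close>

lemma UNIV_bit_eq: "(UNIV :: bit set) = {0, 1}"
  by (metis (full_types) UNIV_eq_I bit_not_one_iff insert_iff)

context super_space
begin

lemma component_unique:
  assumes "y \<in> G i" "x - y \<in> G (i + 1)" "y' \<in> G i" "x - y' \<in> G (i + 1)"
  shows "y' = y"
proof -
  have "y' - y \<in> G i"
    using assms subspace_component subspace_diff by blast
  moreover have "(x - y) - (x - y') \<in> G (i + 1)"
    using assms subspace_component subspace_diff by blast
  then have "y' - y \<in> G (i + 1)" by simp
  ultimately have "y' - y \<in> G 0 \<inter> G 1" by (cases i) auto
  then show ?thesis using components_disjoint by simp
qed

lemma component_eq:
  assumes "y \<in> G i" "x - y \<in> G (i + 1)"
  shows "component G i x = y"
  unfolding component_def using assms component_unique by blast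

lemma component_homogeneous:
  assumes "x \<in> G i"
  shows "component G j x = (if i = j then x else 0)"
proof (cases "i = j")
  case True
  then show ?thesis
    using assms subspace_0[OF subspace_component] by (auto intro: component_eq)
next
  case False
  then have "i = j + 1" by (cases i; cases j) auto
  then show ?thesis
    using False assms subspace_0[OF subspace_component] by (auto intro!: component_eq)
qed

lemma bilinear_ext_homogeneous:
  assumes "x \<in> G i" "y \<in> G j"
    and "\<And>k l z. z \<in> G l \<Longrightarrow> f k l 0 z = 0" "\<And>k l z. z \<in> G k \<Longrightarrow> f k l z 0 = 0"
  shows "bilinear_ext G f x y = f i j x y"
proof -
  have "0 \<in> G k" for k
    using subspace_0[OF subspace_component] .
  then show ?thesis
    using assms
    by (cases i; cases j)
      (simp_all add: bilinear_ext_def UNIV_bit_eq component_homogeneous[OF assms(1)]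
        component_homogeneous[OF assms(2)])
qed

end

context super_comm_algebra
begin

lemma scale_mult_left: "scale c x * y = scale c (x * y)"
  and scale_mult_right: "x * scale c y = scale c (x * y)"
  using scale_left scale_right by simp_all

lemma derD:
  assumes "d \<in> der scale A i"
  shows "Vector_Spaces.linear scale scale d"
    and "\<And>u j. u \<in> A j \<Longrightarrow> d u \<in> A (i + j)"
    and "\<And>u j v. u \<in> A j \<Longrightarrow> d (u * v) = d u * v + scale (psign (i * j)) (u * d v)"
  using assms unfolding der_def by blast+

lemma der_add: "d \<in> der scale A i \<Longrightarrow> d (x + y) = d x + d y"
  by (drule derD(1)) (rule Vector_Spaces.linear.axioms(3)[THEN module_hom.add])

lemma der_scale: "d \<in> der scale A i \<Longrightarrow> d (scale c x) = scale c (d x)"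
  by (drule derD(1)) (rule Vector_Spaces.linear.axioms(3)[THEN module_hom.scale])

lemma der_zero: "d \<in> der scale A i \<Longrightarrow> d 0 = 0"
  using der_scale[of d i 0 0] by simp

lemma A_decompose:
  obtains x y where "x \<in> A 0" "y \<in> A 1" "v = x + y"
  using carrier_eq by blast

lemma derI:
  assumes "\<And>x y. d (x + y) = d x + d y" "\<And>c x. d (scale c x) = scale c (d x)"
    and "\<And>u j. u \<in> A j \<Longrightarrow> d u \<in> A (i + j)"
    and "\<And>u j v. u \<in> A j \<Longrightarrow> d (u * v) = d u * v + scale (psign (i * j)) (u * d v)"
  shows "d \<in> der scale A i"
proof -
  have "Vector_Spaces.linear scale scale d"
    using assms(1,2) by unfold_locales
  then show ?thesis
    using assms(3,4) unfolding der_def by blast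
qed

lemma vector_space_fun: "vector_space (\<lambda>c d v. scale c (d v))"
  by unfold_locales (auto simp: fun_eq_iff scale_right_distrib scale_left_distrib)

lemma vector_space_N: "vector_space (N_scale scale)"
  by unfold_locales
    (auto simp: N_scale_def plus_fun_def scale_right_distrib scale_left_distrib split: prod.splits)

lemma zero_in_der: "0 \<in> der scale A i"
  by (rule derI) (auto simp: subspace_0[OF subspace_component])

lemma add_in_der:
  assumes "d \<in> der scale A i" "d' \<in> der scale A i"
  shows "d + d' \<in> der scale A i"
proof (rule derI)
  show "(d + d') u \<in> A (i + j)" if "u \<in> A j" for u j
    using derD(2)[OF assms(1) that] derD(2)[OF assms(2) that] subspace_add[OF subspace_component]
    unfolding plus_fun_def by blast
  show "(d + d') (u * v) = (d + d') u * v + scale (psign (i * j)) (u * (d + d') v)"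
    if "u \<in> A j" for u j v
    unfolding plus_fun_def derD(3)[OF assms(1) that] derD(3)[OF assms(2) that]
    by (simp only: distrib_left distrib_right scale_right_distrib add_ac)
qed (simp_all add: der_add[OF assms(1)] der_add[OF assms(2)] der_scale[OF assms(1)]
  der_scale[OF assms(2)] scale_right_distrib add_ac)

lemma scale_in_der:
  assumes "d \<in> der scale A i"
  shows "(\<lambda>v. scale c (d v)) \<in> der scale A i"
proof (rule derI)
  show "scale c (d u) \<in> A (i + j)" if "u \<in> A j" for u j
    using derD(2)[OF assms that] subspace_scale[OF subspace_component] by blast
  show "scale c (d (u * v)) = scale c (d u) * v + scale (psign (i * j)) (u * scale c (d v))"
    if "u \<in> A j" for u j v
    unfolding derD(3)[OF assms that]
    by (simp only: scale_mult_left scale_mult_right scale_right_distrib scale_left_commute)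
qed (simp_all add: der_add[OF assms] der_scale[OF assms] scale_right_distrib scale_left_commute)

lemma der_disjoint:
  assumes "d \<in> der scale A 0" "d \<in> der scale A 1"
  shows "d = 0"
proof
  fix v
  have *: "d u = 0" if "u \<in> A j" for u j
  proof -
    have "d u \<in> A (0 + j)" "d u \<in> A (1 + j)"
      using derD(2) assms that by blast+
    then show ?thesis using components_disjoint by (cases j) auto
  qed
  obtain x y where "x \<in> A 0" "y \<in> A 1" "v = x + y" by (rule A_decompose)
  then show "d v = 0 v" using * der_add[OF assms(1)] by simp
qed

lemma super_space_W: "super_space (\<lambda>c d v. scale c (d v)) (W_carrier scale A) (der scale A)"
proof -
  interpret F: vector_space "\<lambda>c d v. scale c (d v)" by (rule vector_space_fun)
  show ?thesis
  proof
    show "F.subspace (der scale A i)" for i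
      by (rule F.subspaceI) (auto intro: zero_in_der add_in_der scale_in_der)
  qed (auto simp: W_carrier_def zero_in_der der_disjoint)
qed

lemma super_space_N: "super_space (N_scale scale) (N_carrier scale A) (N_grading scale A)"
proof -
  interpret F: vector_space "N_scale scale" by (rule vector_space_N)
  show ?thesis
  proof
    show "F.subspace (N_grading scale A i)" for i
      by (rule F.subspaceI)
        (auto simp: N_grading_def N_scale_def zero_prod_def intro: zero_in_der add_in_der
          scale_in_der subspace_0[OF subspace_component] subspace_add[OF subspace_component]
          subspace_scale[OF subspace_component])
    show "N_grading scale A 0 \<inter> N_grading scale A 1 = {0}"
      using components_disjoint by (auto simp: N_grading_def zero_prod_def zero_in_der der_disjoint)
    show "N_carrier scale A =
      {x + y | x y. x \<in> N_grading scale A 0 \<and> y \<in> N_grading scale A 1}"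
    proof (intro equalityI subsetI)
      fix p assume "p \<in> N_carrier scale A"
      then obtain d d' \<xi> where d: "d \<in> der scale A 0" "d' \<in> der scale A 1" "p = (d + d', \<xi>)"
        by (auto simp: N_carrier_def W_carrier_def)
      obtain x y where xy: "x \<in> A 0" "y \<in> A 1" "\<xi> = x + y" by (rule A_decompose)
      have "p = (d, x) + (d', y)" using d xy by simp
      then show "p \<in> {x + y | x y. x \<in> N_grading scale A 0 \<and> y \<in> N_grading scale A 1}"
        using d xy unfolding N_grading_def by blast
    next
      fix p assume "p \<in> {x + y | x y. x \<in> N_grading scale A 0 \<and> y \<in> N_grading scale A 1}"
      then show "p \<in> N_carrier scale A"
        by (auto simp: N_grading_def N_carrier_def W_carrier_def)
    qed
  qed
qed

lemma W_bracket_homogeneous: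
  assumes "d\<^sub>1 \<in> der scale A i" "d\<^sub>2 \<in> der scale A j"
  shows "W_bracket scale A d\<^sub>1 d\<^sub>2 = (\<lambda>v. d\<^sub>1 (d\<^sub>2 v) - scale (psign (i * j)) (d\<^sub>2 (d\<^sub>1 v)))"
  unfolding W_bracket_def
  by (rule super_space.bilinear_ext_homogeneous[OF super_space_W assms])
    (auto simp: fun_eq_iff der_zero)

lemma W_bracket_zero:
  assumes "d \<in> der scale A i"
  shows "W_bracket scale A d 0 = 0" "W_bracket scale A 0 d = 0"
  using W_bracket_homogeneous[OF assms zero_in_der] W_bracket_homogeneous[OF zero_in_der assms]
  by (auto simp: fun_eq_iff der_zero[OF assms])

lemma N_bracket_homogeneous:
  assumes "(d\<^sub>1, \<xi>\<^sub>1) \<in> N_grading scale A i" "(d\<^sub>2, \<xi>\<^sub>2) \<in> N_grading scale A j"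
  shows "N_bracket scale A (d\<^sub>1, \<xi>\<^sub>1) (d\<^sub>2, \<xi>\<^sub>2) =
    (\<lambda>v. d\<^sub>1 (d\<^sub>2 v) - scale (psign (i * j)) (d\<^sub>2 (d\<^sub>1 v)),
     d\<^sub>1 \<xi>\<^sub>2 - scale (psign (i * j)) (d\<^sub>2 \<xi>\<^sub>1))"
proof -
  have "d\<^sub>1 \<in> der scale A i" "d\<^sub>2 \<in> der scale A j"
    using assms by (simp_all add: N_grading_def)
  then show ?thesis
    unfolding N_bracket_def W_bracket_homogeneous[symmetric]
    by (subst super_space.bilinear_ext_homogeneous[OF super_space_N assms])
      (auto simp: N_grading_def zero_prod_def W_bracket_zero W_bracket_homogeneous der_zero)
qed

lemma N_circ_homogeneous:
  assumes "(d\<^sub>1, \<xi>\<^sub>1) \<in> N_grading scale A i" "(d\<^sub>2, \<xi>\<^sub>2) \<in> N_grading scale A j"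
  shows "N_circ scale A (d\<^sub>1, \<xi>\<^sub>1) (d\<^sub>2, \<xi>\<^sub>2) =
    (\<lambda>v. scale (psign (i * j)) (\<xi>\<^sub>2 * d\<^sub>1 v), \<xi>\<^sub>1 * \<xi>\<^sub>2)"
  unfolding N_circ_def
  by (subst super_space.bilinear_ext_homogeneous[OF super_space_N assms])
    (auto simp: N_grading_def zero_prod_def act_def fun_eq_iff)

end

end

theory Submission
  imports Defs
begin

text \<open>
  Both operations are bilinear and graded, so all identities reduce to homogeneous elements,
  including those in which one argument is arbitrary. On these the signs in \<open>\<circ>\<close> are such that
  \<open>\<circ>\<close> is associative; the left supersymmetry of the associator is then trivial, and the right
  supercommutativity is that of \<open>\<A>\<close>. The bracket is the super commutator together with the
  evaluation action, and its compatibility with \<open>\<circ>\<close> is the Leibniz rule for derivations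
  combined with supercommutativity.
\<close>

section \<open>Bilinear extensions\<close>

context super_space
begin

section \<open>Homogeneous components and bilinear extension\<close>

lemma homogeneous_in_carrier: "x \<in> G i \<Longrightarrow> x \<in> V"
  using subspace_0[OF subspace_component, of "i + 1"]
  by (cases i) (auto simp: carrier_eq intro: add_0_right[symmetric] add_0_left[symmetric])

lemma subspace_carrier: "subspace V"
  unfolding carrier_eq by (intro subspace_sums subspace_component)

lemma component_in:
  assumes "x \<in> V"
  shows "component G i x \<in> G i" "x - component G i x \<in> G (i + 1)"
proof -
  obtain y z where yz: "y \<in> G 0" "z \<in> G 1" "x = y + z"
    using assms carrier_eq by blast
  have "component G 0 x = y" "component G 1 x = z"
    using yz by (auto intro: component_eq)
  then show "component G i x \<in> G i" "x - component G i x \<in> G (i + 1)"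
    using yz by (cases i; simp)+
qed

lemma component_add:
  assumes "x \<in> V" "y \<in> V"
  shows "component G i (x + y) = component G i x + component G i y"
proof (rule component_eq)
  show "x + y - (component G i x + component G i y) \<in> G (i + 1)"
    using subspace_add[OF subspace_component component_in(2)[OF assms(1)]
        component_in(2)[OF assms(2)], of i]
    by (simp add: algebra_simps)
qed (intro subspace_add subspace_component component_in assms)

lemma component_scale:
  assumes "x \<in> V"
  shows "component G i (scale c x) = scale c (component G i x)"
proof (rule component_eq)
  show "scale c x - scale c (component G i x) \<in> G (i + 1)"
    unfolding scale_right_diff_distrib[symmetric]
    by (intro subspace_scale subspace_component component_in assms)
qed (intro subspace_scale subspace_component component_in assms)

text \<open>The super Jacobi identity and the compatibility condition leave \<open>w\<close>
  inhomogeneous. Both are additive in \<open>w\<close>, so this rule reduces them to homogeneous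
  \<open>w\<close>.\<close>

lemma carrier_induct [consumes 1, case_names homogeneous add]:
  assumes "w \<in> V"
    and "\<And>i x. x \<in> G i \<Longrightarrow> P x"
    and "\<And>x y. x \<in> V \<Longrightarrow> y \<in> V \<Longrightarrow> P x \<Longrightarrow> P y \<Longrightarrow> P (x + y)"
  shows "P w"
proof -
  obtain x y where xy: "x \<in> G 0" "y \<in> G 1" "w = x + y"
    using assms(1) carrier_eq by blast
  then show ?thesis
    using assms(2,3) homogeneous_in_carrier by simp
qed

text \<open>The projections \<open>component G i\<close> are linear on \<open>V\<close>, so
  bilinearity on each pair of homogeneous parts passes to the double sum. On homogeneous arguments
  only one summand survives, which gives the grading.\<close>

lemma super_algebra_bilinear_ext:
  assumes graded: "\<And>i j x y. x \<in> G i \<Longrightarrow> y \<in> G j \<Longrightarrow> f i j x y \<in> G (i + j)"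
    and add_l: "\<And>i j x y z. x \<in> G i \<Longrightarrow> y \<in> G i \<Longrightarrow> z \<in> G j \<Longrightarrow>
      f i j (x + y) z = f i j x z + f i j y z"
    and add_r: "\<And>i j x y z. x \<in> G i \<Longrightarrow> y \<in> G j \<Longrightarrow> z \<in> G j \<Longrightarrow>
      f i j x (y + z) = f i j x y + f i j x z"
    and scale_l: "\<And>i j c x y. x \<in> G i \<Longrightarrow> y \<in> G j \<Longrightarrow> f i j (scale c x) y = scale c (f i j x y)"
    and scale_r: "\<And>i j c x y. x \<in> G i \<Longrightarrow> y \<in> G j \<Longrightarrow> f i j x (scale c y) = scale c (f i j x y)"
  shows "super_algebra scale V G (bilinear_ext G f)"
proof
  have zero: "0 \<in> G i" for i
    using subspace_0[OF subspace_component] .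
  \<comment> \<open>Additivity at \<open>0 + 0\<close> forces the value 0; this kills the summands
    of the extension that belong to vanishing components.\<close>
  have zero_l: "f i j 0 z = 0" if "z \<in> G j" for i j z
    using add_l[OF zero zero that, of i] by simp
  have zero_r: "f i j z 0 = 0" if "z \<in> G i" for i j z
    using add_r[OF that zero zero, of j] by simp
  show "bilinear_ext G f x y \<in> V" if "x \<in> V" "y \<in> V" for x y
    unfolding bilinear_ext_def
    by (intro subspace_sum[OF subspace_carrier] homogeneous_in_carrier[OF graded]
        component_in that)
  show "bilinear_ext G f x y \<in> G (i + j)" if "x \<in> G i" "y \<in> G j" for x y i j
    using graded[OF that] bilinear_ext_homogeneous[of x i y j f, OF that zero_l zero_r] by simp
  show "bilinear_ext G f (x + y) z = bilinear_ext G f x z + bilinear_ext G f y z"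
    if "x \<in> V" "y \<in> V" "z \<in> V" for x y z
    by (simp add: bilinear_ext_def component_add that add_l component_in sum.distrib)
  show "bilinear_ext G f x (y + z) = bilinear_ext G f x y + bilinear_ext G f x z"
    if "x \<in> V" "y \<in> V" "z \<in> V" for x y z
    by (simp add: bilinear_ext_def component_add that add_r component_in sum.distrib)
  show "bilinear_ext G f (scale c x) y = scale c (bilinear_ext G f x y)"
    if "x \<in> V" "y \<in> V" for c x y
    by (simp add: bilinear_ext_def component_scale that scale_l component_in scale_sum_right)
  show "bilinear_ext G f x (scale c y) = scale c (bilinear_ext G f x y)"
    if "x \<in> V" "y \<in> V" for c x y
    by (simp add: bilinear_ext_def component_scale that scale_r component_in scale_sum_right)
qed

end

section \<open>Derivations and functions\<close>

lemma psign_simps [simp]: "psign 0 = 1" "psign 1 = -1"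
  by (simp_all add: psign_def)

context super_comm_algebra
begin

section \<open>Supercommutators and multiples of derivations\<close>

lemma der_minus: "d \<in> der scale A i \<Longrightarrow> d (- x) = - d x"
  using der_scale[of d i "-1" x] by simp

lemma der_diff: "d \<in> der scale A i \<Longrightarrow> d (x - y) = d x - d y"
  using der_add[of d i x "- y"] by (simp add: der_minus)

text \<open>The mixed terms cancel: for \<open>u\<close> of parity \<open>k\<close>, both composites
  contribute \<open>d\<^sub>1 u * d\<^sub>2 v\<close> with total sign \<open>psign (j * k)\<close>
  and \<open>d\<^sub>2 u * d\<^sub>1 v\<close> with total sign \<open>psign (i * (j + k))\<close>,
  once from each side of the difference.\<close>

lemma commutator_in_der:
  assumes d: "d\<^sub>1 \<in> der scale A i" "d\<^sub>2 \<in> der scale A j"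
  shows "(\<lambda>v. d\<^sub>1 (d\<^sub>2 v) - scale (psign (i * j)) (d\<^sub>2 (d\<^sub>1 v))) \<in> der scale A (i + j)"
    (is "?D \<in> _")
proof (rule derI)
  note lin = der_add[OF d(1)] der_add[OF d(2)] der_scale[OF d(1)] der_scale[OF d(2)]
    der_minus[OF d(1)] der_minus[OF d(2)] der_diff[OF d(1)] der_diff[OF d(2)]
  show "?D (x + y) = ?D x + ?D y" for x y
    by (simp add: lin scale_right_distrib)
  show "?D (scale c x) = scale c (?D x)" for c x
    by (simp add: lin scale_right_diff_distrib scale_left_commute)
  show "?D u \<in> A (i + j + k)" if u: "u \<in> A k" for u k
  proof -
    have "d\<^sub>1 (d\<^sub>2 u) \<in> A (i + j + k)" "d\<^sub>2 (d\<^sub>1 u) \<in> A (i + j + k)"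
      using derD(2)[OF d(1) derD(2)[OF d(2) u]] derD(2)[OF d(2) derD(2)[OF d(1) u]]
      by (simp_all only: ac_simps)
    then show ?thesis
      by (intro subspace_diff subspace_scale subspace_component)
  qed
  \<comment> \<open>Splitting on all parities turns every sign into 1 or -1 and leaves identities in
    a ring. The sign computations below are settled in the same way.\<close>
  show "?D (u * v) = ?D u * v + scale (psign ((i + j) * k)) (u * ?D v)" if u: "u \<in> A k" for u k v
    by (cases i; cases j; cases k)
      (simp_all add: lin derD(3)[OF d(1) u] derD(3)[OF d(2) u]
        derD(3)[OF d(1) derD(2)[OF d(2) u]] derD(3)[OF d(2) derD(2)[OF d(1) u]] algebra_simps)
qed

text \<open>Moving \<open>a\<close> past \<open>u\<close> costs \<open>psign (j * k)\<close>, which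
  combines with the sign \<open>psign (i * k)\<close> of \<open>d\<close> to that of a derivation of
  parity \<open>i + j\<close>. This places the first component of the product in the right
  degree.\<close>

lemma mult_in_der:
  assumes d: "d \<in> der scale A i" and a: "a \<in> A j"
  shows "(\<lambda>v. a * d v) \<in> der scale A (i + j)"
proof (rule derI)
  show "a * d u \<in> A (i + j + k)" if "u \<in> A k" for u k
    using graded[OF a derD(2)[OF d that]] by (simp only: ac_simps)
  show "a * d (u * v) = a * d u * v + scale (psign ((i + j) * k)) (u * (a * d v))"
    if u: "u \<in> A k" for u k v
  proof -
    have "a * d (u * v) = a * d u * v + scale (psign (i * k)) (a * u * d v)"
      by (simp add: derD(3)[OF d u] scale_mult_right distrib_left mult.assoc)
    also have "\<dots> = a * d u * v + scale (psign (i * k)) (scale (psign (j * k)) (u * (a * d v)))"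
      by (simp add: supercommute[OF a u] scale_mult_left mult.assoc)
    finally show ?thesis
      by (cases i; cases j; cases k) simp_all
  qed
qed (simp_all add: der_add[OF d] der_scale[OF d] distrib_left scale_mult_right)

section \<open>The graded bilinear operations on derivations and on the whole space\<close>

lemma super_algebra_W_bracket:
  "super_algebra (\<lambda>c d v. scale c (d v)) (W_carrier scale A) (der scale A) (W_bracket scale A)"
  unfolding W_bracket_def
proof (rule super_space.super_algebra_bilinear_ext[OF super_space_W], goal_cases)
  case (1 i j x y)
  then show ?case by (rule commutator_in_der)
next
  case (2 i j x y z)
  then show ?case
    by (simp add: fun_eq_iff der_add[OF 2(3)] scale_right_distrib)
next
  case (3 i j x y z)
  then show ?case
    by (simp add: fun_eq_iff der_add[OF 3(1)] scale_right_distrib)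
next
  case (4 i j c x y)
  then show ?case
    by (simp add: fun_eq_iff der_scale[OF 4(2)] scale_right_diff_distrib scale_left_commute)
next
  case (5 i j c x y)
  then show ?case
    by (simp add: fun_eq_iff der_scale[OF 5(1)] scale_right_diff_distrib scale_left_commute)
qed

lemma super_algebra_N_bracket:
  "super_algebra (N_scale scale) (N_carrier scale A) (N_grading scale A) (N_bracket scale A)"
  unfolding N_bracket_def
proof -
  \<comment> \<open>The first component of the bracket is itself a bilinear extension, so its
    linearity and grading are taken from the superalgebra of derivations.\<close>
  interpret W: super_algebra "\<lambda>c d v. scale c (d v)" "W_carrier scale A" "der scale A"
    "W_bracket scale A"
    by (rule super_algebra_W_bracket)
  note W = W.homogeneous_in_carrier
  let ?f = "\<lambda>i j (d\<^sub>1, \<xi>\<^sub>1) (d\<^sub>2, \<xi>\<^sub>2).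
    (W_bracket scale A d\<^sub>1 d\<^sub>2, d\<^sub>1 \<xi>\<^sub>2 - scale (psign (i * j)) (d\<^sub>2 \<xi>\<^sub>1))"
  show "super_algebra (N_scale scale) (N_carrier scale A) (N_grading scale A)
    (bilinear_ext (N_grading scale A) ?f)"
  proof (rule super_space.super_algebra_bilinear_ext[OF super_space_N])
    fix x y i j
    assume "x \<in> N_grading scale A i" "y \<in> N_grading scale A j"
    then obtain d\<^sub>1 \<xi>\<^sub>1 d\<^sub>2 \<xi>\<^sub>2 where xy: "x = (d\<^sub>1, \<xi>\<^sub>1)" "y = (d\<^sub>2, \<xi>\<^sub>2)"
      and d: "d\<^sub>1 \<in> der scale A i" "d\<^sub>2 \<in> der scale A j" and \<xi>: "\<xi>\<^sub>1 \<in> A i" "\<xi>\<^sub>2 \<in> A j"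
      unfolding N_grading_def by blast
    have "d\<^sub>2 \<xi>\<^sub>1 \<in> A (i + j)"
      using derD(2)[OF d(2) \<xi>(1)] by (simp only: add.commute)
    then have "d\<^sub>1 \<xi>\<^sub>2 - scale (psign (i * j)) (d\<^sub>2 \<xi>\<^sub>1) \<in> A (i + j)"
      by (intro subspace_diff subspace_scale subspace_component derD(2)[OF d(1) \<xi>(2)])
    then show "?f i j x y \<in> N_grading scale A (i + j)"
      using W.graded[OF d] by (simp add: xy N_grading_def)
    fix c
    show "?f i j (N_scale scale c x) y = N_scale scale c (?f i j x y)"
      "?f i j x (N_scale scale c y) = N_scale scale c (?f i j x y)"
      by (simp_all add: xy N_scale_def W.scale_left[OF W W, OF d] W.scale_right[OF W W, OF d]
          der_scale[OF d(1)] der_scale[OF d(2)] scale_right_diff_distrib scale_left_commute)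
  next
    fix x y z i j
    assume "x \<in> N_grading scale A i" "y \<in> N_grading scale A i" "z \<in> N_grading scale A j"
    then obtain d\<^sub>1 \<xi>\<^sub>1 d\<^sub>2 \<xi>\<^sub>2 d \<zeta> where xyz: "x = (d\<^sub>1, \<xi>\<^sub>1)" "y = (d\<^sub>2, \<xi>\<^sub>2)" "z = (d, \<zeta>)"
      and d: "d\<^sub>1 \<in> der scale A i" "d\<^sub>2 \<in> der scale A i" "d \<in> der scale A j"
      unfolding N_grading_def by blast
    show "?f i j (x + y) z = ?f i j x z + ?f i j y z"
      by (simp add: xyz W.add_left[OF W W W, OF d] der_add[OF d(3)] scale_right_distrib)
  next
    fix x y z i j
    assume "x \<in> N_grading scale A i" "y \<in> N_grading scale A j" "z \<in> N_grading scale A j"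
    then obtain d\<^sub>1 \<xi>\<^sub>1 d\<^sub>2 \<xi>\<^sub>2 d \<zeta> where xyz: "x = (d\<^sub>1, \<xi>\<^sub>1)" "y = (d\<^sub>2, \<xi>\<^sub>2)" "z = (d, \<zeta>)"
      and d: "d\<^sub>1 \<in> der scale A i" "d\<^sub>2 \<in> der scale A j" "d \<in> der scale A j"
      unfolding N_grading_def by blast
    show "?f i j x (y + z) = ?f i j x y + ?f i j x z"
      by (simp add: xyz W.add_right[OF W W W, OF d] der_add[OF d(1)] scale_right_distrib)
  qed
qed

lemma super_algebra_N_circ:
  "super_algebra (N_scale scale) (N_carrier scale A) (N_grading scale A) (N_circ scale A)"
  unfolding N_circ_def
proof (rule super_space.super_algebra_bilinear_ext[OF super_space_N], goal_cases)
  case (1 i j x y)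
  then obtain d\<^sub>1 \<xi>\<^sub>1 d\<^sub>2 \<xi>\<^sub>2 where xy: "x = (d\<^sub>1, \<xi>\<^sub>1)" "y = (d\<^sub>2, \<xi>\<^sub>2)"
    and d: "d\<^sub>1 \<in> der scale A i" and \<xi>: "\<xi>\<^sub>1 \<in> A i" "\<xi>\<^sub>2 \<in> A j"
    unfolding N_grading_def by blast
  show ?case
    using scale_in_der[OF mult_in_der[OF d \<xi>(2)]] graded[OF \<xi>]
    by (simp add: xy N_grading_def act_def)
\<comment> \<open>Linearity in each argument is pointwise. Nested scalings merge into one scalar,
  and the instance of \<open>mult.commute\<close> puts the sign behind the arbitrary factor
  \<open>c\<close> on both sides.\<close>
qed (simp_all add: N_scale_def act_def case_prod_beta prod_eq_iff fun_eq_iff distrib_left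
    distrib_right scale_right_distrib scale_mult_left scale_mult_right
    mult.commute[of "psign _"])

lemma N_bracket_in:
  "\<lbrakk>x \<in> N_grading scale A i; y \<in> N_grading scale A j\<rbrakk> \<Longrightarrow>
    N_bracket scale A x y \<in> N_grading scale A (i + j)"
  by (rule super_algebra.graded[OF super_algebra_N_bracket])

lemma N_circ_in:
  "\<lbrakk>x \<in> N_grading scale A i; y \<in> N_grading scale A j\<rbrakk> \<Longrightarrow>
    N_circ scale A x y \<in> N_grading scale A (i + j)"
  by (rule super_algebra.graded[OF super_algebra_N_circ])

section \<open>The Lie superalgebra identities\<close>

lemma N_bracket_skew:
  assumes u: "u \<in> N_grading scale A i" and v: "v \<in> N_grading scale A j"
  shows "N_bracket scale A u v = - N_scale scale (psign (i * j)) (N_bracket scale A v u)"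
proof -
  obtain d\<^sub>1 \<xi>\<^sub>1 d\<^sub>2 \<xi>\<^sub>2 where uv: "u = (d\<^sub>1, \<xi>\<^sub>1)" "v = (d\<^sub>2, \<xi>\<^sub>2)"
    by (metis surj_pair)
  show ?thesis
    unfolding uv N_bracket_homogeneous[OF u[unfolded uv] v[unfolded uv]]
      N_bracket_homogeneous[OF v[unfolded uv] u[unfolded uv]]
    by (cases i; cases j) (simp_all add: N_scale_def fun_eq_iff)
qed

text \<open>The bracket is that of the semidirect product of the derivations with their module
  \<open>A\<close>, taken as an abelian ideal. By linearity both sides expand into composites of
  three derivations in the first component, and of two derivations applied to an element of the
  algebra in the second; these match with signs.\<close>

lemma N_jacobi_homogeneous:
  assumes u: "u \<in> N_grading scale A i" and v: "v \<in> N_grading scale A j"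
    and w: "w \<in> N_grading scale A l"
  shows "N_bracket scale A w (N_bracket scale A v u) =
    N_bracket scale A (N_bracket scale A w v) u
    - N_scale scale (psign (i * j)) (N_bracket scale A (N_bracket scale A w u) v)"
proof -
  obtain d\<^sub>1 \<xi>\<^sub>1 d\<^sub>2 \<xi>\<^sub>2 d \<zeta> where uvw: "u = (d\<^sub>1, \<xi>\<^sub>1)" "v = (d\<^sub>2, \<xi>\<^sub>2)" "w = (d, \<zeta>)"
    by (metis surj_pair)
  note u = u[unfolded uvw] and v = v[unfolded uvw] and w = w[unfolded uvw]
  have d: "d\<^sub>1 \<in> der scale A i" "d\<^sub>2 \<in> der scale A j" "d \<in> der scale A l"
    using u v w by (auto simp: N_grading_def)
  note lin = der_add[OF d(1)] der_add[OF d(2)] der_add[OF d(3)]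
    der_minus[OF d(1)] der_minus[OF d(2)] der_minus[OF d(3)]
    der_diff[OF d(1)] der_diff[OF d(2)] der_diff[OF d(3)]
  note vu = N_bracket_homogeneous[OF v u] and wv = N_bracket_homogeneous[OF w v]
    and wu = N_bracket_homogeneous[OF w u]
  \<comment> \<open>The inner brackets are homogeneous of the sum parity. Rewriting these
    memberships into pair form lets the homogeneous formula evaluate the outer brackets too.\<close>
  show ?thesis
    unfolding uvw vu wv wu
      N_bracket_homogeneous[OF w N_bracket_in[OF v u, unfolded vu]]
      N_bracket_homogeneous[OF N_bracket_in[OF w v, unfolded wv] u]
      N_bracket_homogeneous[OF N_bracket_in[OF w u, unfolded wu] v]
    by (cases i; cases j; cases l) (simp_all add: N_scale_def fun_eq_iff lin)
qed

section \<open>The Novikov identities\<close>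

text \<open>Right factors enter only through their function parts and parities, so the two sides
  differ by the order of \<open>\<xi>\<^sub>2\<close> and \<open>\<zeta>\<close>.\<close>

lemma N_circ_right_supercommute:
  assumes u: "u \<in> N_grading scale A i" and v: "v \<in> N_grading scale A j"
    and w: "w \<in> N_grading scale A l"
  shows "N_circ scale A (N_circ scale A u v) w =
    N_scale scale (psign (j * l)) (N_circ scale A (N_circ scale A u w) v)"
proof -
  obtain d\<^sub>1 \<xi>\<^sub>1 d\<^sub>2 \<xi>\<^sub>2 d \<zeta> where uvw: "u = (d\<^sub>1, \<xi>\<^sub>1)" "v = (d\<^sub>2, \<xi>\<^sub>2)" "w = (d, \<zeta>)"
    by (metis surj_pair)
  note u = u[unfolded uvw] and v = v[unfolded uvw] and w = w[unfolded uvw]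
  have "\<xi>\<^sub>2 \<in> A j" "\<zeta> \<in> A l"
    using v w by (auto simp: N_grading_def)
  then have comm: "\<xi>\<^sub>2 * \<zeta> = scale (psign (j * l)) (\<zeta> * \<xi>\<^sub>2)"
    by (rule supercommute)
  \<comment> \<open>Products are normalised to right-nested form, where the pair to be exchanged is
    followed by a further factor.\<close>
  then have comm': "\<xi>\<^sub>2 * (\<zeta> * x) = scale (psign (j * l)) (\<zeta> * (\<xi>\<^sub>2 * x))" for x
    by (metis mult.assoc scale_mult_left)
  note uv = N_circ_homogeneous[OF u v] and uw = N_circ_homogeneous[OF u w]
  show ?thesis
    unfolding uvw uv uw
      N_circ_homogeneous[OF N_circ_in[OF u v, unfolded uv] w]
      N_circ_homogeneous[OF N_circ_in[OF u w, unfolded uw] v]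
    by (cases i; cases j; cases l)
      (use comm comm' in \<open>simp_all add: N_scale_def fun_eq_iff mult.assoc\<close>)
qed

text \<open>The sign makes \<open>psign (i * j)\<close> times
  \<open>\<xi>\<^sub>2 * d\<^sub>1 v\<close> the right module action of \<open>\<xi>\<^sub>2\<close>
  on \<open>d\<^sub>1\<close> obtained from the left one. Both components are thus right actions of
  the function parts, and acting successively by \<open>\<xi>\<^sub>2\<close> and
  \<open>\<zeta>\<close> is acting by their product.\<close>

lemma N_circ_assoc:
  assumes u: "u \<in> N_grading scale A i" and v: "v \<in> N_grading scale A j"
    and w: "w \<in> N_grading scale A l"
  shows "N_circ scale A (N_circ scale A u v) w = N_circ scale A u (N_circ scale A v w)"
proof -
  obtain d\<^sub>1 \<xi>\<^sub>1 d\<^sub>2 \<xi>\<^sub>2 d \<zeta> where uvw: "u = (d\<^sub>1, \<xi>\<^sub>1)" "v = (d\<^sub>2, \<xi>\<^sub>2)" "w = (d, \<zeta>)"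
    by (metis surj_pair)
  note u = u[unfolded uvw] and v = v[unfolded uvw] and w = w[unfolded uvw]
  have "\<xi>\<^sub>2 \<in> A j" "\<zeta> \<in> A l"
    using v w by (auto simp: N_grading_def)
  then have "\<xi>\<^sub>2 * \<zeta> = scale (psign (j * l)) (\<zeta> * \<xi>\<^sub>2)"
    by (rule supercommute)
  then have comm: "\<xi>\<^sub>2 * (\<zeta> * x) = scale (psign (j * l)) (\<zeta> * (\<xi>\<^sub>2 * x))" for x
    by (metis mult.assoc scale_mult_left)
  note uv = N_circ_homogeneous[OF u v] and vw = N_circ_homogeneous[OF v w]
  show ?thesis
    unfolding uvw uv vw
      N_circ_homogeneous[OF N_circ_in[OF u v, unfolded uv] w]
      N_circ_homogeneous[OF u N_circ_in[OF v w, unfolded vw]]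
    by (cases i; cases j; cases l)
      (use comm in \<open>simp_all add: fun_eq_iff mult.assoc\<close>)
qed

section \<open>Compatibility of bracket and product\<close>

text \<open>Up to signs, the bracket of \<open>\<xi>\<^sub>1 d\<close> with \<open>d\<^sub>2\<close>
  is \<open>\<xi>\<^sub>1\<close> times that of \<open>d\<close> with \<open>d\<^sub>2\<close>,
  corrected by \<open>d\<^sub>2(\<xi>\<^sub>1) d\<close>. The former cancels against a product of a
  bracket, the correction against the product of \<open>w\<close> with the bracket of
  \<open>u\<close> and \<open>v\<close>; likewise with \<open>u\<close> and \<open>v\<close>
  exchanged.\<close>

lemma N_compatible_homogeneous:
  assumes u: "u \<in> N_grading scale A i" and v: "v \<in> N_grading scale A j"
    and w: "w \<in> N_grading scale A l"
  shows "N_bracket scale A (N_circ scale A w u) v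
      - N_scale scale (psign (i * j)) (N_bracket scale A (N_circ scale A w v) u)
      + N_circ scale A (N_bracket scale A w u) v
      - N_scale scale (psign (i * j)) (N_circ scale A (N_bracket scale A w v) u)
      - N_circ scale A w (N_bracket scale A u v) = 0"
proof -
  obtain d\<^sub>1 \<xi>\<^sub>1 d\<^sub>2 \<xi>\<^sub>2 d \<zeta> where uvw: "u = (d\<^sub>1, \<xi>\<^sub>1)" "v = (d\<^sub>2, \<xi>\<^sub>2)" "w = (d, \<zeta>)"
    by (metis surj_pair)
  note u = u[unfolded uvw] and v = v[unfolded uvw] and w = w[unfolded uvw]
  have d: "d\<^sub>1 \<in> der scale A i" "d\<^sub>2 \<in> der scale A j" "d \<in> der scale A l"
    and \<xi>: "\<xi>\<^sub>1 \<in> A i" "\<xi>\<^sub>2 \<in> A j" "\<zeta> \<in> A l"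
    using u v w by (auto simp: N_grading_def)
  note lin = der_add[OF d(1)] der_add[OF d(2)] der_add[OF d(3)]
    der_minus[OF d(1)] der_minus[OF d(2)] der_minus[OF d(3)]
    der_diff[OF d(1)] der_diff[OF d(2)] der_diff[OF d(3)]
  \<comment> \<open>These are the left factors that \<open>d\<^sub>1\<close> and
    \<open>d\<^sub>2\<close> meet: \<open>\<xi>\<^sub>2\<close> and \<open>\<xi>\<^sub>1\<close> in
    the first component, \<open>\<zeta>\<close> in the second.\<close>
  note leibniz = derD(3)[OF d(1) \<xi>(2)] derD(3)[OF d(1) \<xi>(3)]
    derD(3)[OF d(2) \<xi>(1)] derD(3)[OF d(2) \<xi>(3)]
  \<comment> \<open>In the second component these are the only products occurring in both orders;
    every other pair cancels after the Leibniz rule.\<close>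
  have comm: "d \<xi>\<^sub>1 * \<xi>\<^sub>2 = scale (psign ((l + i) * j)) (\<xi>\<^sub>2 * d \<xi>\<^sub>1)"
    "d \<xi>\<^sub>2 * \<xi>\<^sub>1 = scale (psign ((l + j) * i)) (\<xi>\<^sub>1 * d \<xi>\<^sub>2)"
    by (rule supercommute[OF derD(2)[OF d(3) \<xi>(1)] \<xi>(2)])
      (rule supercommute[OF derD(2)[OF d(3) \<xi>(2)] \<xi>(1)])
  note wu = N_circ_homogeneous[OF w u] and wv = N_circ_homogeneous[OF w v]
    and bwu = N_bracket_homogeneous[OF w u] and bwv = N_bracket_homogeneous[OF w v]
    and buv = N_bracket_homogeneous[OF u v]
  show ?thesis
    unfolding uvw wu wv bwu bwv buv
      N_bracket_homogeneous[OF N_circ_in[OF w u, unfolded wu] v]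
      N_bracket_homogeneous[OF N_circ_in[OF w v, unfolded wv] u]
      N_circ_homogeneous[OF N_bracket_in[OF w u, unfolded bwu] v]
      N_circ_homogeneous[OF N_bracket_in[OF w v, unfolded bwv] u]
      N_circ_homogeneous[OF w N_bracket_in[OF u v, unfolded buv]]
    by (cases i; cases j; cases l)
      (simp_all add: N_scale_def zero_prod_def fun_eq_iff lin leibniz comm algebra_simps)
qed

end

section \<open>Passage from homogeneous to arbitrary \<open>w\<close>\<close>

theorem theorem3p1:
  fixes scale :: "complex \<Rightarrow> 'a::ring \<Rightarrow> 'a" and A :: "bit \<Rightarrow> 'a set"
  assumes "super_comm_algebra scale A"
  shows "super_gelfand_dorfman (N_scale scale) (N_carrier scale A) (N_grading scale A)
    (N_bracket scale A) (N_circ scale A)"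
proof -
  interpret super_comm_algebra scale A by (rule assms)
  interpret B: super_algebra "N_scale scale" "N_carrier scale A" "N_grading scale A" "N_bracket scale A"
    by (rule super_algebra_N_bracket)
  interpret C: super_algebra "N_scale scale" "N_carrier scale A" "N_grading scale A" "N_circ scale A"
    by (rule super_algebra_N_circ)
  note carrier = B.homogeneous_in_carrier B.closed C.closed
  show ?thesis
  proof
    fix u v w i j
    assume u: "u \<in> N_grading scale A i" and v: "v \<in> N_grading scale A j"
    note uv = carrier(1)[OF u] carrier(1)[OF v]
    show "N_bracket scale A u v = - N_scale scale (psign (i * j)) (N_bracket scale A v u)"
      using u v by (rule N_bracket_skew)
    assume "w \<in> N_carrier scale A"
    then show "N_bracket scale A w (N_bracket scale A v u) =
      N_bracket scale A (N_bracket scale A w v) u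
      - N_scale scale (psign (i * j)) (N_bracket scale A (N_bracket scale A w u) v)"
    proof (induction rule: B.carrier_induct)
      case (add x y)
      then show ?case
        by (simp add: uv carrier B.add_left B.scale_right_distrib)
    qed (rule N_jacobi_homogeneous[OF u v])
  next
    fix u v w i j
    assume u: "u \<in> N_grading scale A i" and v: "v \<in> N_grading scale A j"
      and "w \<in> N_carrier scale A"
    note uv = carrier(1)[OF u] carrier(1)[OF v]
    show "N_bracket scale A (N_circ scale A w u) v
      - N_scale scale (psign (i * j)) (N_bracket scale A (N_circ scale A w v) u)
      + N_circ scale A (N_bracket scale A w u) v
      - N_scale scale (psign (i * j)) (N_circ scale A (N_bracket scale A w v) u)
      - N_circ scale A w (N_bracket scale A u v) = 0" (is "?P w")
      using \<open>w \<in> N_carrier scale A\<close>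
    proof (induction rule: B.carrier_induct)
      case (add x y)
      \<comment> \<open>The identities for \<open>x\<close> and \<open>y\<close> are added and
        regrouped in the shape that the one for \<open>x + y\<close> takes once additivity has split
        each of its five terms.\<close>
      have "a + a' - (b + b') + (c + c') - (e + e') - (f + f') = 0"
        if "a - b + c - e - f = 0" "a' - b' + c' - e' - f' = 0"
        for a a' b b' c c' e e' f f' :: "('a \<Rightarrow> 'a) \<times> 'a"
        using arg_cong2[OF that, of "(+)"] by (simp add: algebra_simps)
      from this[OF add.IH] show ?case
        using add.hyps by (simp add: uv carrier B.add_left C.add_left B.scale_right_distrib)
    qed (rule N_compatible_homogeneous[OF u v])
  next
    fix u v w i j l
    assume uvw: "u \<in> N_grading scale A i" "v \<in> N_grading scale A j" "w \<in> N_grading scale A l"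
    show "N_circ scale A (N_circ scale A u v) w =
        N_scale scale (psign (j * l)) (N_circ scale A (N_circ scale A u w) v)"
      using uvw by (rule N_circ_right_supercommute)
    show "N_circ scale A (N_circ scale A u v) w - N_circ scale A u (N_circ scale A v w) =
        N_scale scale (psign (i * j))
          (N_circ scale A (N_circ scale A v u) w - N_circ scale A v (N_circ scale A u w))"
      by (simp add: N_circ_assoc[OF uvw] N_circ_assoc[OF uvw(2,1,3)])
  qed
qed

end
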